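(* Let $q \geq 7$ be a prime power, and let $F(X) \in \mathbb{F}_q[X]$ be an irreducible polynomial of degree $r \geq 2$. Then every non-zero residue class modulo $F$ contains a polynomial $f \in \mathbb{F}_q[X]$ which is non-constant, square-free, and $(r-1)$-smooth.
   Context: $\mathbb{F}_q$ denotes the finite field with $q$ elements. A polynomial $f \in \mathbb{F}_q[X]$ is called $k$-smooth if it has no irreducible factor of degree exceeding $k$, and square-free if it is not divisible by the square of an irreducible polynomial. *)

theory Defs
  imports
    "HOL-Library.Cardinality"
    "HOL-Computational_Algebra.Computational_Algebra"
    "HOL-Number_Theory.Cong"
begin

text \<open>
  The zero polynomial is divisible by every polynomial, so over a field with irreducible
  polynomials of arbitrarily large degree (such as a finite field) it is not smooth for any
  bound. Non-zero constants are smooth for every bound.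
\<close>

definition smooth_poly :: "nat \<Rightarrow> 'a :: field poly \<Rightarrow> bool" where
  "smooth_poly k f \<longleftrightarrow> (\<forall>p. irreducible p \<and> p dvd f \<longrightarrow> degree p \<le> k)"

lemma irreducible_factor_exists:
  fixes x :: "'a :: field poly"
  assumes "\<not> x dvd 1"
  shows "\<exists>p. irreducible p \<and> p dvd x"
  using assms
proof (induction "degree x" arbitrary: x rule: less_induct)
  case less
  show ?case
  proof (cases "x = 0")
    case True
    have "irreducible [:0, 1 :: 'a:]"
      by (rule irreducible_linear_field_poly) simp
    with True show ?thesis by auto
  next
    case x0: False
    show ?thesis
    proof (cases "irreducible x")
      case True
      then show ?thesis by auto
    next
      case False
      with x0 less.prems obtain a b where ab: "x = a * b" "\<not> a dvd 1" "\<not> b dvd 1"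
        by (auto simp: irreducible_def)
      with x0 have nz: "a \<noteq> 0" "b \<noteq> 0" by auto
      with ab have "degree b > 0" by (auto simp: is_unit_iff_degree)
      with ab nz have "degree a < degree x" by (simp add: degree_mult_eq)
      from less.hyps[OF this ab(2)] ab(1) show ?thesis by auto
    qed
  qed
qed

text \<open>
  The library lemma relating \<^const>\<open>squarefree\<close> to prime factors is stated for factorial
  semirings, of which \<open>'a poly\<close> is not an instance when \<open>'a\<close> is merely a field.
\<close>

lemma squarefree_iff_irreducible:
  fixes f :: "'a :: field poly"
  shows "squarefree f \<longleftrightarrow> \<not> (\<exists>p. irreducible p \<and> p ^ 2 dvd f)"
proof
  assume "squarefree f"
  then show "\<not> (\<exists>p. irreducible p \<and> p ^ 2 dvd f)"
    by (auto simp: squarefree_def irreducible_def)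
next
  assume *: "\<not> (\<exists>p. irreducible p \<and> p ^ 2 dvd f)"
  show "squarefree f"
  proof (rule squarefreeI, rule ccontr)
    fix x assume x: "x ^ 2 dvd f" "\<not> x dvd 1"
    from irreducible_factor_exists[OF x(2)] obtain p where "irreducible p" "p dvd x"
      by auto
    with x(1) * show False by (meson dvd_power_same dvd_trans)
  qed
qed

end

theory Submission
  imports Defs
begin

text \<open>
  Let \<open>D\<close> be the set of the \<open>q ^ r - 1\<close> non-zero polynomials of degree less than \<open>r\<close>, and
  consider the triples in \<open>D\<close> with \<open>u * v * w\<close> congruent to \<open>a\<close> modulo \<open>F\<close>. Any two
  coordinates can be prescribed freely and determine the third, so conditions on one or two
  coordinates can be counted without knowing anything about \<open>a\<close>. By a union bound over monic
  divisors, a coordinate fails to be square-free, and likewise a pair of coordinates fails to be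
  coprime, for a proportion of less than \<open>1 / (q - 1)\<close> of the triples. The six failures together
  have proportion less than \<open>6 / (q - 1) \<le> 1\<close>, and the margin exceeds the number of triples
  with \<open>u\<close> and \<open>v\<close> constant.
\<close>

section \<open>Counting polynomials of bounded degree\<close>

definition nonzero_polys :: "nat \<Rightarrow> 'a :: zero poly set" where
  "nonzero_polys n = {p. p \<noteq> 0 \<and> degree p < n}"

definition monic_polys :: "nat \<Rightarrow> 'a :: {zero, one} poly set" where
  "monic_polys n = {p. lead_coeff p = 1 \<and> degree p = n}"

text \<open>Zero is put back because \<open>pCons 0 0 = 0\<close>: with it the set is a full space
  of coefficient lists, and each further degree multiplies its size by
  \<open>CARD('a)\<close>.\<close>

lemma insert_0_nonzero_polys_Suc:
  "insert 0 (nonzero_polys (Suc n)) =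
     (\<lambda>(c :: 'a :: zero, p). pCons c p) ` (UNIV \<times> insert 0 (nonzero_polys n))"
proof (intro equalityI subsetI)
  fix p :: "'a poly" assume p: "p \<in> insert 0 (nonzero_polys (Suc n))"
  obtain c s where ps: "p = pCons c s" by (cases p)
  have "s \<in> insert 0 (nonzero_polys n)"
    using p unfolding ps by (auto simp: nonzero_polys_def split: if_splits)
  then show "p \<in> (\<lambda>(c, p). pCons c p) ` (UNIV \<times> insert 0 (nonzero_polys n))"
    using ps by auto
qed (auto simp: nonzero_polys_def degree_pCons_eq_if)

lemma
  shows finite_nonzero_polys: "finite (nonzero_polys n :: 'a :: {zero, finite} poly set)"
    and card_nonzero_polys: "card (nonzero_polys n :: 'a poly set) = CARD('a) ^ n - 1"
proof -
  have *: "finite (insert 0 (nonzero_polys n :: 'a poly set)) \<and>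
    card (insert 0 (nonzero_polys n :: 'a poly set)) = CARD('a) ^ n"
  proof (induction n)
    case 0
    then show ?case by (simp add: nonzero_polys_def)
  next
    case (Suc n)
    have "inj_on (\<lambda>(c :: 'a, p). pCons c p) (UNIV \<times> insert 0 (nonzero_polys n))"
      by (auto simp: inj_on_def)
    then show ?case
      unfolding insert_0_nonzero_polys_Suc
      using Suc by (simp add: card_image card_cartesian_product del: finite_insert)
  qed
  then show fin: "finite (nonzero_polys n :: 'a poly set)" by simp
  have "0 \<notin> (nonzero_polys n :: 'a poly set)" by (simp add: nonzero_polys_def)
  with * fin show "card (nonzero_polys n :: 'a poly set) = CARD('a) ^ n - 1"
    by (metis card_insert_disjoint diff_Suc_1)
qed

text \<open>A monic polynomial is \<open>monom 1 n\<close> plus a polynomial of degree below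
  \<open>n\<close> or zero. One inclusion is enough, since union bounds only use an upper
  estimate.\<close>

lemma
  shows finite_monic_polys: "finite (monic_polys n :: 'a :: {comm_ring_1, finite} poly set)"
    and card_monic_polys_le: "card (monic_polys n :: 'a poly set) \<le> CARD('a) ^ n"
proof -
  let ?V = "insert 0 (nonzero_polys n) :: 'a poly set"
  have "l \<in> (\<lambda>p. monom 1 n + p) ` ?V" if l: "l \<in> monic_polys n" for l :: "'a poly"
  proof -
    have "coeff (l - monom 1 n) i = 0" if "i \<ge> n" for i
      using that l by (cases "i = n") (auto simp: monic_polys_def coeff_eq_0)
    then have "l - monom 1 n = 0 \<or> degree (l - monom 1 n) < n"
      by (metis leading_coeff_0_iff not_le)
    then have "l - monom 1 n \<in> ?V" by (auto simp: nonzero_polys_def)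
    then show ?thesis by (rule rev_image_eqI) simp
  qed
  then have sub: "monic_polys n \<subseteq> (\<lambda>p. monom 1 n + p) ` ?V" by blast
  have fin: "finite ?V" by (simp add: finite_nonzero_polys)
  show "finite (monic_polys n :: 'a poly set)"
    using sub fin by (meson finite_imageI finite_subset)
  have "card (monic_polys n :: 'a poly set) \<le> card ?V"
    using sub fin by (metis card_image_le card_mono finite_imageI le_trans)
  also have "\<dots> = CARD('a) ^ n"
    by (simp add: card_insert_if finite_nonzero_polys card_nonzero_polys)
       (simp add: nonzero_polys_def)
  finally show "card (monic_polys n :: 'a poly set) \<le> CARD('a) ^ n" .
qed

text \<open>The cofactor of a multiple ranges over non-zero polynomials of degree below
  \<open>n - degree l\<close>. If \<open>degree l \<ge> n\<close>, truncated subtraction makes the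
  bound 0, in agreement with the absence of multiples.\<close>

lemma card_multiples_le:
  fixes l :: "'a :: {field, finite} poly"
  assumes "l \<noteq> 0"
  shows "card {u \<in> nonzero_polys n. l dvd u} \<le> CARD('a) ^ (n - degree l) - 1"
proof -
  have "{u \<in> nonzero_polys n. l dvd u} \<subseteq> (*) l ` nonzero_polys (n - degree l)"
    using assms by (auto simp: nonzero_polys_def dvd_def degree_mult_eq)
  then have "card {u \<in> nonzero_polys n. l dvd u} \<le>
      card (nonzero_polys (n - degree l) :: 'a poly set)"
    by (meson card_image_le card_mono finite_imageI finite_nonzero_polys le_trans)
  then show ?thesis by (simp add: card_nonzero_polys)
qed

text \<open>Restricting to monic divisors leaves at most \<open>q ^ j\<close> of them in degree
  \<open>j\<close>; without this the union bound would lose a factor \<open>q - 1\<close>.\<close>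

lemma ex_monic_associate:
  fixes l :: "'a :: field poly"
  assumes "l \<noteq> 0"
  obtains m where "lead_coeff m = 1" "degree m = degree l" "m dvd l"
proof
  let ?m = "smult (inverse (lead_coeff l)) l"
  show "lead_coeff ?m = 1" "degree ?m = degree l" using assms by auto
  show "?m dvd l" using assms by (simp add: smult_dvd_iff)
qed

section \<open>Union bounds over monic divisors\<close>

lemma card_UN_monic_le:
  fixes A :: "'a :: {field, finite} poly \<Rightarrow> 'b set"
  assumes "\<And>l. lead_coeff l = 1 \<Longrightarrow> degree l = j \<Longrightarrow> card (A l) \<le> c"
  shows "card (\<Union>l\<in>monic_polys j. A l) \<le> CARD('a) ^ j * c"
proof -
  have "card (\<Union>l\<in>monic_polys j. A l) \<le> (\<Sum>l\<in>monic_polys j. card (A l))"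
    by (rule card_UN_le) (rule finite_monic_polys)
  also have "\<dots> \<le> card (monic_polys j :: 'a poly set) * c"
    using sum_bounded_above[of "monic_polys j :: 'a poly set" "\<lambda>l. card (A l)" c] assms
    by (auto simp: monic_polys_def)
  also have "\<dots> \<le> CARD('a) ^ j * c" by (intro mult_right_mono card_monic_polys_le) simp
  finally show ?thesis .
qed

text \<open>Common frame for both kinds of failure: \<open>C\<close> is the size of the sample
  space, \<open>A l\<close> the failures caused by the divisor \<open>l\<close>. The degrees run
  over \<open>1..<r\<close> because a divisor that is not a unit has degree at least 1 and divides a
  non-zero polynomial of degree below \<open>r\<close>.\<close>

lemma card_union_bound:
  fixes A :: "'a :: {field, finite} poly \<Rightarrow> 'b set" and C :: real
  assumes sub: "B \<subseteq> (\<Union>j\<in>{1..<r}. \<Union>l\<in>monic_polys j. A l)"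
    and fin: "\<And>l. finite (A l)"
    and cA: "\<And>l. lead_coeff l = 1 \<Longrightarrow> card (A l) \<le> c (degree l)"
    and c: "\<And>j. j \<in> {1..<r} \<Longrightarrow> real (CARD('a) ^ j * c j) \<le> C / real CARD('a) ^ j"
  shows "real (card B) \<le> C * (\<Sum>j=1..<r. 1 / real CARD('a) ^ j)"
proof -
  have "card B \<le> card (\<Union>j\<in>{1..<r}. \<Union>l\<in>monic_polys j. A l)"
    by (rule card_mono[OF _ sub]) (auto intro: fin finite_monic_polys)
  also have "\<dots> \<le> (\<Sum>j=1..<r. card (\<Union>l\<in>monic_polys j. A l))"
    by (rule card_UN_le) simp
  also have "\<dots> \<le> (\<Sum>j=1..<r. CARD('a) ^ j * c j)"
    by (intro sum_mono card_UN_monic_le) (use cA in auto)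
  finally have "real (card B) \<le> (\<Sum>j=1..<r. real (CARD('a) ^ j * c j))"
    by (metis of_nat_le_iff of_nat_sum)
  also have "\<dots> \<le> (\<Sum>j=1..<r. C / real CARD('a) ^ j)"
    by (rule sum_mono) (rule c)
  finally show ?thesis by (simp add: sum_distrib_left)
qed

text \<open>Among non-zero polynomials, multiples of a given divisor of degree \<open>j\<close> have
  proportion at most \<open>1 / q ^ j\<close>: removing the zero polynomial only helps, as
  \<open>q ^ n - q ^ j \<le> q ^ n - 1\<close>.\<close>

lemma real_power_diff_le:
  fixes q :: nat
  assumes "q \<ge> 1"
  shows "real (q ^ (n - j) - 1) \<le> (real q ^ n - 1) / real q ^ j"
proof (cases "j \<le> n")
  case True
  have "real q ^ j \<ge> 1" using assms by simp
  then have "real q ^ n - real q ^ j \<le> real q ^ n - 1" by simp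
  moreover have "real q ^ n = real q ^ (n - j) * real q ^ j"
    using True by (simp flip: power_add)
  ultimately show ?thesis using assms by (simp add: of_nat_diff field_simps)
next
  case False
  then show ?thesis using assms by simp
qed

text \<open>In degree \<open>j\<close> there are at most \<open>q ^ j\<close> squares
  \<open>l ^ 2\<close>, each dividing a proportion of at most \<open>1 / q ^ (2 * j)\<close>, which
  leaves \<open>1 / q ^ j\<close>.\<close>

lemma card_non_squarefree_le:
  "real (card {u \<in> nonzero_polys r. \<not> squarefree (u :: 'a :: {field, finite} poly)}) \<le>
     (real CARD('a) ^ r - 1) * (\<Sum>j=1..<r. 1 / real CARD('a) ^ j)"
proof (rule card_union_bound)
  let ?A = "\<lambda>l :: 'a poly. {u \<in> nonzero_polys r. l ^ 2 dvd u}"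
  show "{u \<in> nonzero_polys r. \<not> squarefree u} \<subseteq> (\<Union>j\<in>{1..<r}. \<Union>l\<in>monic_polys j. ?A l)"
  proof
    fix u :: "'a poly" assume "u \<in> {u \<in> nonzero_polys r. \<not> squarefree u}"
    then have u: "u \<noteq> 0" "degree u < r" "u \<in> nonzero_polys r"
      and "\<not> squarefree u" by (auto simp: nonzero_polys_def)
    then obtain x where x: "x ^ 2 dvd u" "\<not> x dvd 1" by (auto simp: squarefree_def)
    with u have x0: "x \<noteq> 0" by auto
    then obtain m where m: "lead_coeff m = 1" "degree m = degree x" "m dvd x"
      by (rule ex_monic_associate)
    have "degree x > 0" using x(2) x0 by (auto simp: is_unit_iff_degree)
    moreover have "degree x < r"
      using dvd_imp_degree_le[OF x(1) u(1)] u(2) x0 by (simp add: degree_power_eq)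
    moreover have "m ^ 2 dvd u" using m(3) x(1) by (meson dvd_power_same dvd_trans)
    ultimately show "u \<in> (\<Union>j\<in>{1..<r}. \<Union>l\<in>monic_polys j. ?A l)"
      using m u(3) by (intro UN_I[of "degree x"] UN_I[of m]) (auto simp: monic_polys_def)
  qed
  show "finite (?A l)" for l by (simp add: finite_nonzero_polys)
  show "card (?A l) \<le> CARD('a) ^ (r - 2 * degree l) - 1" if "lead_coeff l = 1" for l
    using card_multiples_le[of "l ^ 2" r] that by (cases "l = 0") (auto simp: degree_power_eq)
  show "real (CARD('a) ^ j * (CARD('a) ^ (r - 2 * j) - 1)) \<le> (real CARD('a) ^ r - 1) / real CARD('a) ^ j"
    for j
    using real_power_diff_le[of "CARD('a)" r "2 * j"]
    by (simp add: field_simps power_add mult_2_right)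
qed

text \<open>Here \<open>l\<close> must divide two independent coordinates, so its proportion is
  again at most \<open>1 / q ^ (2 * j)\<close> and the same sum results.\<close>

lemma card_non_coprime_le:
  "real (card {(u, v) \<in> nonzero_polys r \<times> nonzero_polys r. \<not> coprime u (v :: 'a :: {field, finite} poly)}) \<le>
     (real CARD('a) ^ r - 1) ^ 2 * (\<Sum>j=1..<r. 1 / real CARD('a) ^ j)"
proof (rule card_union_bound)
  let ?D = "nonzero_polys r :: 'a poly set"
  let ?A = "\<lambda>l :: 'a poly. {u \<in> ?D. l dvd u} \<times> {u \<in> ?D. l dvd u}"
  show "{(u, v) \<in> ?D \<times> ?D. \<not> coprime u v} \<subseteq> (\<Union>j\<in>{1..<r}. \<Union>l\<in>monic_polys j. ?A l)"
  proof clarify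
    fix u v :: "'a poly" assume uv: "u \<in> ?D" "v \<in> ?D" "\<not> coprime u v"
    then obtain x where x: "x dvd u" "x dvd v" "\<not> x dvd 1" by (auto simp: coprime_def)
    have u: "u \<noteq> 0" "degree u < r" using uv by (auto simp: nonzero_polys_def)
    with x have x0: "x \<noteq> 0" by auto
    then obtain m where m: "lead_coeff m = 1" "degree m = degree x" "m dvd x"
      by (rule ex_monic_associate)
    have "degree x > 0" using x(3) x0 by (auto simp: is_unit_iff_degree)
    moreover have "degree x < r" using dvd_imp_degree_le[OF x(1) u(1)] u(2) by simp
    moreover have "m dvd u" "m dvd v" using m(3) x by (meson dvd_trans)+
    ultimately show "(u, v) \<in> (\<Union>j\<in>{1..<r}. \<Union>l\<in>monic_polys j. ?A l)"
      using m uv by (intro UN_I[of "degree x"] UN_I[of m]) (auto simp: monic_polys_def)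
  qed
  show "finite (?A l)" for l by (simp add: finite_nonzero_polys)
  show "card (?A l) \<le> (CARD('a) ^ (r - degree l) - 1) ^ 2" if "lead_coeff l = 1" for l
  proof -
    have "l \<noteq> 0" using that by auto
    then show ?thesis
      unfolding card_cartesian_product power2_eq_square
      by (intro mult_mono card_multiples_le) auto
  qed
  show "real (CARD('a) ^ j * (CARD('a) ^ (r - j) - 1) ^ 2) \<le> (real CARD('a) ^ r - 1) ^ 2 / real CARD('a) ^ j"
    for j
  proof -
    have "real (CARD('a) ^ (r - j) - 1) ^ 2 \<le> ((real CARD('a) ^ r - 1) / real CARD('a) ^ j) ^ 2"
      by (intro power_mono real_power_diff_le) auto
    then have "real CARD('a) ^ j * real (CARD('a) ^ (r - j) - 1) ^ 2
      \<le> real CARD('a) ^ j * ((real CARD('a) ^ r - 1) / real CARD('a) ^ j) ^ 2"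
      by (intro mult_left_mono) auto
    then show ?thesis by (simp add: power2_eq_square)
  qed
qed

section \<open>Square-free products of coprime factors\<close>

lemma squarefree_mult_coprime_field_poly:
  fixes u v :: "'a :: field poly"
  assumes "squarefree u" "squarefree v" "coprime u v"
  shows "squarefree (u * v)"
  unfolding squarefree_iff_irreducible
proof clarify
  fix p assume p: "irreducible p" "p ^ 2 dvd u * v"
  have prime: "prime_elem p" using p(1) by (rule field_poly_irreducible_imp_prime)
  \<comment> \<open>After one \<open>p\<close> is cancelled, primality pushes the other into the
    cofactor of \<open>x\<close>, so the whole square lies in the factor that \<open>p\<close>
    divides.\<close>
  have square: "p ^ 2 dvd x" if "p dvd x" "\<not> p dvd y" "p ^ 2 dvd x * y" for x y
  proof -
    obtain z where z: "x = p * z" using \<open>p dvd x\<close> ..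
    have "p \<noteq> 0" using p(1) by auto
    then have "p dvd z * y" using that(3) unfolding z by (simp add: power2_eq_square mult.assoc)
    then have "p dvd z" using prime that(2) by (auto simp: prime_elem_dvd_mult_iff)
    then show ?thesis unfolding z by (simp add: power2_eq_square)
  qed
  have "\<not> (p dvd u \<and> p dvd v)"
    using assms(3) p(1) by (auto simp: coprime_def irreducible_def)
  moreover have "p dvd u \<or> p dvd v"
    using p(2) prime by (metis dvd_trans dvd_triv_left power2_eq_square prime_elem_dvd_mult_iff)
  ultimately have "p ^ 2 dvd u \<or> p ^ 2 dvd v"
    using square[of u v] square[of v u] p(2) by (auto simp: mult.commute)
  then show False using assms(1,2) p(1) by (auto simp: squarefree_iff_irreducible)
qed

lemma coprime_mult_left_field_poly:
  fixes u v w :: "'a :: field poly"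
  assumes "coprime u w" "coprime v w"
  shows "coprime (u * v) w"
proof (rule coprimeI, rule ccontr)
  fix x assume x: "x dvd u * v" "x dvd w" "\<not> x dvd 1"
  obtain p where p: "irreducible p" "p dvd x" using irreducible_factor_exists[OF x(3)] by blast
  have "p dvd u \<or> p dvd v"
    using field_poly_irreducible_imp_prime[OF p(1)] p(2) x(1)
    by (meson dvd_trans prime_elem_dvd_mult_iff)
  moreover have "p dvd w" using p x by (meson dvd_trans)
  ultimately show False using assms p(1) by (auto simp: coprime_def irreducible_def)
qed

section \<open>Linear congruences modulo an irreducible polynomial\<close>

lemma not_dvd_nonzero_polys: "p \<in> nonzero_polys (degree F) \<Longrightarrow> \<not> F dvd p"
  for F :: "'a :: idom poly"
  using dvd_imp_degree_le[of F p] by (auto simp: nonzero_polys_def)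

text \<open>Primality of \<open>F\<close> cancels \<open>b\<close>, and a non-zero difference of two
  reduced residues has too small a degree to be divisible by \<open>F\<close>.\<close>

lemma cofactor_unique_mod_prime:
  fixes F b :: "'a :: field poly"
  assumes "irreducible F" "\<not> F dvd b"
    and w: "w \<in> nonzero_polys (degree F)" "w' \<in> nonzero_polys (degree F)"
    and "[b * w = b * w'] (mod F)"
  shows "w = w'"
proof (rule ccontr)
  assume "w \<noteq> w'"
  moreover have "degree (w - w') < degree F"
    using w by (auto simp: nonzero_polys_def intro: degree_diff_less)
  ultimately have "\<not> F dvd w - w'"
    by (intro not_dvd_nonzero_polys) (simp add: nonzero_polys_def)
  moreover have "F dvd b * (w - w')"
    using assms(5) by (simp add: cong_iff_dvd_diff algebra_simps)
  ultimately show False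
    using field_poly_irreducible_imp_prime[OF assms(1)] assms(2)
    by (simp add: prime_elem_dvd_mult_iff)
qed

text \<open>Multiplication by \<open>b\<close> followed by reduction is an injective self-map of the
  finite set of non-zero residues, hence surjective.\<close>

lemma ex_cofactor_mod_prime:
  fixes F a b :: "'a :: {field, finite} poly"
  assumes F: "irreducible F" and b: "\<not> F dvd b" and a: "\<not> F dvd a"
  shows "\<exists>w \<in> nonzero_polys (degree F). [b * w = a] (mod F)"
proof -
  let ?D = "nonzero_polys (degree F) :: 'a poly set"
  have F0: "F \<noteq> 0" using F by auto
  have mod_in: "x mod F \<in> ?D" if "\<not> F dvd x" for x
    using that F0 degree_mod_less[of F x] by (auto simp: nonzero_polys_def dvd_eq_mod_eq_0)
  have "(\<lambda>w. b * w mod F) ` ?D \<subseteq> ?D"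
    using field_poly_irreducible_imp_prime[OF F] b
    by (auto intro!: mod_in dest: not_dvd_nonzero_polys simp: prime_elem_dvd_mult_iff)
  moreover have "inj_on (\<lambda>w. b * w mod F) ?D"
    by (auto intro!: inj_onI cofactor_unique_mod_prime[OF F b] simp: cong_def)
  ultimately have "(\<lambda>w. b * w mod F) ` ?D = ?D"
    using finite_nonzero_polys endo_inj_surj by blast
  then have "a mod F \<in> (\<lambda>w. b * w mod F) ` ?D" using mod_in[OF a] by simp
  then show ?thesis by (auto simp: cong_def)
qed

section \<open>Summing the proportions and counting triples\<close>

lemma sum_inverse_powers:
  fixes q :: real
  assumes "q > 0" "r \<ge> 1"
  shows "(q - 1) * (\<Sum>j=1..<r. 1 / q ^ j) = 1 - 1 / q ^ (r - 1)"
  using assms(2)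
proof (induction r rule: dec_induct)
  case (step n)
  then obtain m where "n = Suc m" by (cases n) auto
  with step assms(1) show ?case by (simp add: field_simps)
qed simp

lemma degree_le_if_irreducible_dvd:
  "p \<in> nonzero_polys r \<Longrightarrow> x dvd p \<Longrightarrow> degree x \<le> r - 1" for p :: "'a :: idom poly"
  using dvd_imp_degree_le[of x p] by (auto simp: nonzero_polys_def)

theorem theorem1p1:
  fixes F :: "'a :: {field, finite} poly" and q r :: nat
  assumes "q = CARD('a)" and "q \<ge> 7"
    and "irreducible F" and "degree F = r" and "r \<ge> 2"
  shows "\<forall>a. \<not> [a = 0] (mod F) \<longrightarrow>
    (\<exists>f. [f = a] (mod F) \<and> degree f > 0 \<and> squarefree f \<and> smooth_poly (r - 1) f)"
proof (intro allI impI)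
  fix a :: "'a poly" assume "\<not> [a = 0] (mod F)"
  then have a: "\<not> F dvd a" by (simp add: cong_0_iff)
  have prime: "prime_elem F" using assms(3) by (rule field_poly_irreducible_imp_prime)
  define D where "D = (nonzero_polys r :: 'a poly set)"
  define T where "T = {(u, v, w). u \<in> D \<and> v \<in> D \<and> w \<in> D \<and> [u * v * w = a] (mod F)}"
  define N where "N = {u \<in> D. \<not> squarefree u}"
  \<comment> \<open>Only the first coordinate is tested for square-freeness. Applied to the cyclic
    pairs \<open>(u, v)\<close>, \<open>(v, w)\<close>, \<open>(w, u)\<close>, membership in
    \<open>B\<close> then tests each coordinate and each pair exactly once.\<close>
  define B where "B = N \<times> D \<union> {(u, v) \<in> D \<times> D. \<not> coprime u v}"
  \<comment> \<open>\<open>nonzero_polys 1\<close> consists of the non-zero constants; avoiding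
    \<open>E\<close> makes \<open>u\<close> or \<open>v\<close> non-constant, whatever
    \<open>w\<close> is.\<close>
  define E where "E = (nonzero_polys 1 \<times> nonzero_polys 1 :: ('a poly \<times> 'a poly) set)"
  define M where "M = real q ^ r - 1"
  define S where "S = (\<Sum>j=1..<r. 1 / real q ^ j)"
  have finD: "finite D" by (simp add: D_def finite_nonzero_polys)
  have cardD: "real (card D) = M"
    using assms(1,2) by (simp add: D_def M_def card_nonzero_polys of_nat_diff)
  have ndvd: "\<not> F dvd u * v" if "u \<in> D" "v \<in> D" for u v
    using that prime not_dvd_nonzero_polys[of _ F] assms(4)
    by (auto simp: D_def prime_elem_dvd_mult_iff)
  have unique: "w = w'"
    if "u \<in> D" "v \<in> D" "w \<in> D" "w' \<in> D" "[u * v * w = a] (mod F)" "[u * v * w' = a] (mod F)"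
    for u v w w'
    using cofactor_unique_mod_prime[OF assms(3) ndvd, of u v w w'] that assms(4)
    by (auto simp: D_def intro: cong_trans cong_sym)

  \<comment> \<open>Every pair extends to a triple, which bounds \<open>card T\<close> from
    below.\<close>
  have "D \<times> D \<subseteq> (\<lambda>(u, v, w). (u, v)) ` T"
  proof clarify
    fix u v assume uv: "u \<in> D" "v \<in> D"
    obtain w where "w \<in> D" "[u * v * w = a] (mod F)"
      using ex_cofactor_mod_prime[OF assms(3) ndvd[OF uv] a] assms(4) by (auto simp: D_def)
    with uv show "(u, v) \<in> (\<lambda>(u, v, w). (u, v)) ` T" by (force simp: T_def)
  qed
  moreover have finT: "finite T"
    by (rule finite_subset[of _ "D \<times> D \<times> D"]) (auto simp: T_def finD)
  ultimately have "card D * card D \<le> card T"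
    by (metis card_cartesian_product surj_card_le)
  then have M_le: "M\<^sup>2 \<le> real (card T)"
    by (metis cardD of_nat_le_iff of_nat_mult power2_eq_square)

  have inj: "inj_on (\<lambda>(u, v, w). (u, v)) T" "inj_on (\<lambda>(u, v, w). (v, w)) T"
    "inj_on (\<lambda>(u, v, w). (w, u)) T"
  proof -
    show "inj_on (\<lambda>(u, v, w). (u, v)) T"
      unfolding inj_on_def T_def by clarsimp (rule unique)
    show "inj_on (\<lambda>(u, v, w). (v, w)) T"
      unfolding inj_on_def T_def
    proof clarsimp
      fix u u' v w assume "u \<in> D" "u' \<in> D" "v \<in> D" "w \<in> D"
        "[u * v * w = a] (mod F)" "[u' * v * w = a] (mod F)"
      then show "u = u'" using unique[of v w u u'] by (simp add: ac_simps)
    qed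
    show "inj_on (\<lambda>(u, v, w). (w, u)) T"
      unfolding inj_on_def T_def
    proof clarsimp
      fix u v v' w assume "u \<in> D" "v \<in> D" "v' \<in> D" "w \<in> D"
        "[u * v * w = a] (mod F)" "[u * v' * w = a] (mod F)"
      then show "v = v'" using unique[of w u v v'] by (simp add: ac_simps)
    qed
  qed
  \<comment> \<open>Two coordinates determine the third, so there are at most as many bad triples as
    bad pairs.\<close>
  have card_vimage: "card {t \<in> T. h t \<in> C} \<le> card C" if "inj_on h T" "finite C"
    for h :: "_ \<Rightarrow> 'a poly \<times> 'a poly" and C
    by (rule card_inj_on_le[of h]) (use that in \<open>auto intro: inj_on_subset\<close>)

  have finB: "finite B" unfolding B_def N_def
    by (rule finite_subset[of _ "D \<times> D"]) (auto simp: finD)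
  have finE: "finite E" by (simp add: E_def finite_nonzero_polys)
  have "real (card N) * M \<le> (M * S) * M"
    using card_non_squarefree_le[where 'a = 'a, of r] cardD
    by (intro mult_right_mono) (auto simp: N_def D_def M_def S_def assms(1))
  moreover have "real (card {(u, v) \<in> D \<times> D. \<not> coprime u v}) \<le> M\<^sup>2 * S"
    using card_non_coprime_le[where 'a = 'a, of r] by (simp add: D_def M_def S_def assms(1))
  moreover have "real (card B) \<le> real (card N) * M + real (card {(u, v) \<in> D \<times> D. \<not> coprime u v})"
    using card_Un_le[of "N \<times> D" "{(u, v) \<in> D \<times> D. \<not> coprime u v}"]
    unfolding B_def cardD[symmetric] card_cartesian_product of_nat_mult[symmetric]
      of_nat_add[symmetric] of_nat_le_iff .
  ultimately have cardB: "real (card B) \<le> 2 * M\<^sup>2 * S"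
    by (simp add: power2_eq_square algebra_simps)
  have cardE: "real (card E) = (real q - 1)\<^sup>2"
    using assms(1,2) by (simp add: E_def card_cartesian_product card_nonzero_polys of_nat_diff
      power2_eq_square)

  \<comment> \<open>\<open>1 / Q\<close> is the amount by which \<open>(q - 1) * S\<close> falls
    short of 1. The resulting margin \<open>M\<^sup>2 / Q\<close> is at least
    \<open>(q - 1)\<^sup>2 * Q\<close>, and \<open>Q > 1\<close>, from \<open>r \<ge> 2\<close>,
    puts it strictly above \<open>card E\<close>.\<close>
  define Q where "Q = real q ^ (r - 1)"
  have Q1: "Q > 1" unfolding Q_def using assms by (intro one_less_power) auto
  have "M \<ge> (real q - 1) * Q"
    using Q1 assms(5) by (cases r) (auto simp: M_def Q_def algebra_simps)
  then have "M\<^sup>2 \<ge> ((real q - 1) * Q)\<^sup>2"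
    using Q1 assms(2) by (intro power_mono) auto
  moreover have "(real q - 1)\<^sup>2 * Q < (real q - 1)\<^sup>2 * Q\<^sup>2"
    using Q1 assms(2) by (intro mult_strict_left_mono) (auto simp: power2_eq_square)
  ultimately have "(real q - 1)\<^sup>2 * Q < M\<^sup>2" by (simp add: power_mult_distrib)
  then have E_less: "(real q - 1)\<^sup>2 < M\<^sup>2 / Q" using Q1 by (simp add: field_simps)
  have "S \<ge> 0" unfolding S_def by (intro sum_nonneg) auto
  \<comment> \<open>The 6 counts three cyclic pairs with two failures each; \<open>q \<ge> 7\<close>
    replaces it by the factor \<open>q - 1\<close> of the geometric sum.\<close>
  then have "6 * S \<le> (real q - 1) * S" using assms(2) by (intro mult_right_mono) auto
  also have "\<dots> = 1 - 1 / Q"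
    using sum_inverse_powers[of "real q" r] assms by (simp add: S_def Q_def)
  finally have "M\<^sup>2 * (6 * S) \<le> M\<^sup>2 * (1 - 1 / Q)" by (intro mult_left_mono) auto
  then have "6 * (M\<^sup>2 * S) \<le> M\<^sup>2 - M\<^sup>2 / Q" by (simp add: right_diff_distrib)
  with E_less cardB cardE M_le have less: "3 * real (card B) + real (card E) < real (card T)"
    by linarith

  have "\<exists>(u, v, w) \<in> T. (u, v) \<notin> B \<and> (v, w) \<notin> B \<and> (w, u) \<notin> B \<and> (u, v) \<notin> E"
  proof (rule ccontr)
    assume none: "\<not> ?thesis"
    have "T \<subseteq> {t \<in> T. (\<lambda>(u, v, w). (u, v)) t \<in> B} \<union> {t \<in> T. (\<lambda>(u, v, w). (v, w)) t \<in> B}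
      \<union> {t \<in> T. (\<lambda>(u, v, w). (w, u)) t \<in> B} \<union> {t \<in> T. (\<lambda>(u, v, w). (u, v)) t \<in> E}"
      (is "_ \<subseteq> ?A1 \<union> ?A2 \<union> ?A3 \<union> ?A4")
    proof
      fix t assume t: "t \<in> T"
      obtain u v w where "t = (u, v, w)" by (cases t)
      with t none show "t \<in> ?A1 \<union> ?A2 \<union> ?A3 \<union> ?A4" by auto
    qed
    then have "card T \<le> card (?A1 \<union> ?A2 \<union> ?A3 \<union> ?A4)"
      by (rule card_mono[rotated]) (simp add: finT)
    also have "\<dots> \<le> card ?A1 + card ?A2 + card ?A3 + card ?A4"
      by (meson add_right_mono card_Un_le le_trans)
    also have "\<dots> \<le> card B + card B + card B + card E"
      by (intro add_mono card_vimage inj finB finE)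
    finally show False using less by simp
  qed
  then obtain u v w where T: "(u, v, w) \<in> T"
    and good: "(u, v) \<notin> B" "(v, w) \<notin> B" "(w, u) \<notin> B" "(u, v) \<notin> E" by blast
  from T have D: "u \<in> D" "v \<in> D" "w \<in> D" and cong: "[u * v * w = a] (mod F)"
    by (auto simp: T_def)
  then have nz: "u \<noteq> 0" "v \<noteq> 0" "w \<noteq> 0" by (auto simp: D_def nonzero_polys_def)
  have sqf: "squarefree u" "squarefree v" "squarefree w"
    and cop: "coprime u v" "coprime v w" "coprime u w"
    using good D by (auto simp: B_def N_def coprime_commute)
  have "squarefree (u * v * w)"
    by (intro squarefree_mult_coprime_field_poly coprime_mult_left_field_poly sqf cop)
  moreover have "degree (u * v * w) > 0"
    using nz good(4) by (auto simp: degree_mult_eq E_def nonzero_polys_def)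
  \<comment> \<open>Smoothness is automatic: an irreducible divisor of the product divides one of
    three factors of degree below \<open>r\<close>.\<close>
  moreover have "smooth_poly (r - 1) (u * v * w)"
    unfolding smooth_poly_def
  proof clarify
    fix p :: "'a poly" assume p: "irreducible p" "p dvd u * v * w"
    then have "p dvd u \<or> p dvd v \<or> p dvd w"
      using field_poly_irreducible_imp_prime[OF p(1)] by (auto simp: prime_elem_dvd_mult_iff)
    then show "degree p \<le> r - 1"
      using D degree_le_if_irreducible_dvd unfolding D_def by blast
  qed
  ultimately show "\<exists>f. [f = a] (mod F) \<and> degree f > 0 \<and> squarefree f \<and> smooth_poly (r - 1) f"
    using cong by blast
qed

end
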